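(* For Hénon maps with parameters in $\mathcal{WY}$, the folding pattern and the pruned tree are equivalent: given one of them, the other one can be recovered. That is, each of the two determines the other: for any two Hénon maps $F_1,F_2$ with parameters in $\mathcal{WY}$, the folding patterns of $F_1$ and $F_2$ coincide if and only if their pruned trees coincide.
   Context: **Wang–Young parameters.** $F_{a,b}(x,y)=(1+y-ax^2,bx)$ on $\mathbb R^2$; $q_a(x)=1-ax^2$. $q_a$ is a Misiurewicz map if there are no $x\in[-1,1]$, $n\ge 1$ with $q_a^n(x)=x$ and $|(q_a^n)'(x)|\le 1$, and $\inf_{n>0}|q_a^n(0)|>0$. The set $\mathcal{WY}$ is the set of parameters given by the following theorem of Wang and Young (2001), taken as known. Let $a^*\in[1.5,2]$ be such that $q_{a^*}$ is Misiurewicz. There are closed intervals $I,I_0$ with $q_a(I)\subset\mathrm{Int}\,I_0\subset I_0\subset\mathrm{Int}\,I$, constants $\kappa,\alpha,\delta,c>0$, $0<\rho<1$, a rectangle $[a_0,a_1]\times(0,b_0]$ arbitrarily near $(a^*,0)$ on which $b\ll\alpha,\delta,\rho,e^{-c}$ and $F_{a,b}$ maps $R=I\times[-\kappa b,\kappa b]$ strictly into $I_0\times[-\kappa b,\kappa b]$, and a positive measure set of $(a,b)$ in it (with slices $\{a\}$ of positive length for all small $b$) for which (1),(2) below hold; the same is valid for $b<0$. $\mathcal{WY}$ consists of all parameters so obtained, $b$ of either sign. Write $F=F_{a,b}$ with $(a,b)\in\mathcal{WY}$. Here $R_0\subset R$ is obtained by replacing the two vertical sides of $R$ by curves $\omega_1,\omega_2$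 joining top and bottom of $R$ over the two components of $I\setminus I_0$ and lying on stable manifolds of periodic orbits; $\partial_hR_0$ is its horizontal boundary. For $b<0$ one uses instead: $\omega_1$ meets the unstable manifold $W^u_Y$ of the fixed point $Y$ (see below) in two or three points $P_1,P_2,(P_3)$, listed from above, and $R_0$ is the region bounded by $[P_1,P_2]\subset\omega_1$ and the arc $[P_1,P_2]^u_Y\subset W^u_Y$, with $\partial_hR_0=[P_1,P_2]^u_Y$. Put $R_k=F^k(R_0)$, $\partial_hR_k=F^k(\partial_hR_0)$, and $\Lambda_F=\bigcap_kR_k$ (the strange attractor). (1) There is a Cantor set $\mathcal C\subset\Lambda_F$, the critical set, $\mathcal C=\bigcap_{k\ge0}\mathcal C^{(k)}$, with $\mathcal C^{(k)}$ decreasing, where $\mathcal C^{(0)}=\{(x,y)\in R_0:|x|<\delta\}$; $\mathcal C^{(k)}$ has finitely many components $Q^{(k)}$, each diffeomorphic to a rectangle bounded by two segments of $\partial_hR_k$ with slopes and curvature $O(b)$ and by two vertical segments, with horizontal boundaries of length $\approx\min(2\delta,\rho^k)$ at Hausdorff distance $O(b^{k/2})$; each $Q^{(k-1)}\cap R_k$ has at most two components, each lying between two segments of $\partial_hR_k$ stretching across $Q^{(k-1)}$ and each containing exactly one component of $\mathcal C^{(k)}$. (2) On each horizontal boundary $\eta$ of each $Q^{(k)}$ there is a unique point $z$ with $\|DF^j(z)(0,1)^T\|\ge\kappa^{-1}e^{cj}$ for all $j\ge1$ and $\|DF^n(z)\tau\|<(\kappa b)^n$ for all $n\ge1$ ($\tau$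 unit tangent to $\eta$ at $z$). $\mathcal C$ is the accumulation set of these points. The forward orbits of points of $\mathcal C$ stay away from $\mathcal C$ (distance to $\mathcal C$ at time $j\ge 1$ at least $\kappa^{-1}e^{-\alpha j}$), so $F^i(z)\notin\mathcal C$ for $z\in\mathcal C$, $i\ne0$. **Notation.** $F$ has two fixed points: $X\in\Lambda_F$ and $Y\notin\Lambda_F$. $W^u$ is the unstable manifold of $X$, and $\Lambda_F=\overline{W^u}$. $P^j=F^j(P)$. $\mathfrak C=\mathcal C\cap W^u$ is the (countable) set of basic critical points, indexed by $\mathbb Z$: $z_0$ is the first one on $W^u$ to the left of $X$ (with $X$ between $z_0$ and $z_0^1$), $W^{u-}$ is the half of $W^u$ from $X$ containing $z_0$, $W^{u+}$ the other half, $z_k\in W^{u-}$, $z_{-k}\in W^{u+}$ for $k\ge1$, and $z_i,z_j$ are consecutive on $W^u$ iff $|i-j|=1$. $F|_{W^u}$ is a homeomorphism fixing $X$ and exchanging $W^{u+}$ and $W^{u-}$. The basic points are the points of $\bigcup_{n\ge0}F^n(\mathfrak C)$. **Folding pattern.** Let $\varphi:\mathbb R\to W^u$ be a parametrization with $\varphi(0)=X$, $\varphi(\mathbb Z\setminus\{0\})$ equal to the set of basic points, $\varphi(-1)=z_0$, $\varphi(1)=z_0^1$. The folding pattern of $F$ is the sequence $(s_k)_{k\in\mathbb Z\setminus\{0\}}$ with $s_k=0$ if $\varphi(k)\in\mathfrak C$ and $s_k=1$ if $\varphi(k)\in\bigcup_{n\ge1}F^n(\mathfrak C)$ (with a decimal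 point at the place of $X$). **Pruned tree.** A basic arc is an arc of $W^u$ whose endpoints are two consecutive basic points. Index the basic arcs by integers: $I_0$ is the arc of $W^u$ between $z_0$ and $z_0^1$ (it contains $X$), $I_n\subset W^{u+}$ and $I_{-n}\subset W^{u-}$ for $n\ge1$, and $I_i\cap I_j\neq\emptyset$ iff $|i-j|\le1$. The pruned tree of $F$ is the directed graph with one vertex $n$ for each basic arc $I_n$ and an arrow from $i$ to $j$ iff $F(I_i)\supset I_j$. Except for the loop at $0$ and the arrow $0\to-1$, it is a sub-tree of the full binary tree rooted at $-1$. Level $0$ consists of $0$, level $1$ of $-1$, and $i$ is at level $n+1$ if the path from $-1$ to $i$ has $n$ arrows. It is regarded as embedded in the plane, so that the left-to-right order of the vertices in each level is given: in each level $n\ge1$ the vertices are ordered left to right by increasing modulus (negative numbers on odd levels, positive numbers on even levels). The pruned tree is considered as such a planar graph without the numbers; two pruned trees coincide if there is a graph isomorphism preserving levels and the left-to-right order on each level. *)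

theory Defs
  imports "HOL-Analysis.Analysis"
begin

type_synonym plane = "real \<times> real"

section \<open>Henon maps and their invariant sets\<close>

definition henon :: "real \<Rightarrow> real \<Rightarrow> plane \<Rightarrow> plane" where
  "henon a b = (\<lambda>(x, y). (1 + y - a * x\<^sup>2, b * x))"

definition quad :: "real \<Rightarrow> real \<Rightarrow> real" where
  "quad a x = 1 - a * x\<^sup>2"

definition misiurewicz :: "real \<Rightarrow> bool" where
  "misiurewicz a \<longleftrightarrow>
     \<not> (\<exists>x\<in>{-1..1}. \<exists>n\<ge>1. (quad a ^^ n) x = x \<and> \<bar>deriv (quad a ^^ n) x\<bar> \<le> 1) \<and>
     (INF n\<in>{0<..}. \<bar>(quad a ^^ n) 0\<bar>) > 0"

definition stable_set :: "(plane \<Rightarrow> plane) \<Rightarrow> plane \<Rightarrow> plane set" where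
  "stable_set F p = {q. (\<lambda>n. dist ((F ^^ n) q) ((F ^^ n) p)) \<longlonglongrightarrow> 0}"

definition unstable_set :: "(plane \<Rightarrow> plane) \<Rightarrow> plane \<Rightarrow> plane set" where
  "unstable_set F p = {q. (\<lambda>n. (inv F ^^ n) q) \<longlonglongrightarrow> p}"

text \<open>
  A parametrization of the unstable manifold of the fixed point \<open>p\<close> by the line. The unstable
  manifold is an immersed curve that accumulates on itself, so arcs and the order along it refer
  to its leaf topology and not to the topology of the plane. A continuous injection of the line
  onto the unstable set might still connect the pieces of the curve in a wrong way (think of a
  figure eight); the last clause excludes this by demanding that \<open>F\<close> acts continuously on the
  parameter line, i.e. that \<open>F\<close> is continuous in the leaf topology.
\<close>

definition unstable_param :: "(plane \<Rightarrow> plane) \<Rightarrow> plane \<Rightarrow> (real \<Rightarrow> plane) \<Rightarrow> bool" where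
  "unstable_param F p \<psi> \<longleftrightarrow>
     continuous_on UNIV \<psi> \<and> inj \<psi> \<and> \<psi> 0 = p \<and> range \<psi> = unstable_set F p \<and>
     (\<exists>h. continuous_on UNIV h \<and> (\<forall>t. F (\<psi> t) = \<psi> (h t)))"


section \<open>Wang--Young parameters\<close>

text \<open>
  The constants of the Wang--Young theorem: \<open>I = [I_lo, I_hi]\<close>, \<open>I\<^sub>0 = [J_lo, J_hi]\<close>, and one
  constant \<open>bigO\<close> that is used for all the estimates \<open>O(b)\<close>, \<open>O(b^(k/2))\<close> and \<open>\<approx>\<close>. It is uniform
  in \<open>k\<close> and in the parameters of one rectangle.
\<close>

record wy_consts =
  I_lo :: real
  I_hi :: real
  J_lo :: real
  J_hi :: real
  kappa :: real
  alpha :: real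
  delta :: real
  cexp :: real
  rho :: real
  bigO :: real

definition rect_R :: "wy_consts \<Rightarrow> real \<Rightarrow> plane set" where
  "rect_R K b = {I_lo K..I_hi K} \<times> {- (kappa K * \<bar>b\<bar>)..kappa K * \<bar>b\<bar>}"

text \<open>
  A curve in \<open>A \<times> [-\<kappa>|b|, \<kappa>|b|]\<close> joining bottom to top, and lying on the stable manifold of a
  periodic point.
\<close>

definition wy_side :: "wy_consts \<Rightarrow> real \<Rightarrow> real \<Rightarrow> real set \<Rightarrow> (real \<Rightarrow> plane) \<Rightarrow> bool" where
  "wy_side K a b A \<omega> \<longleftrightarrow>
     arc \<omega> \<and> fst ` path_image \<omega> \<subseteq> A \<and>
     snd (pathstart \<omega>) = - (kappa K * \<bar>b\<bar>) \<and> snd (pathfinish \<omega>) = kappa K * \<bar>b\<bar> \<and>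
     (\<forall>t\<in>{0<..<1}. \<bar>snd (\<omega> t)\<bar> < kappa K * \<bar>b\<bar>) \<and>
     (\<exists>p. (\<exists>n\<ge>1. (henon a b ^^ n) p = p) \<and> path_image \<omega> \<subseteq> stable_set (henon a b) p)"

text \<open>
  \<open>R0\<close> and its horizontal boundary \<open>hR0\<close>. In both cases \<open>R0\<close> is a Jordan curve together with its
  inside. For \<open>b < 0\<close> the two or three points of \<open>\<omega>\<^sub>1 \<inter> W\<^sup>u(Y)\<close> are \<open>P1\<close>, \<open>P2\<close>, \<open>P3\<close>, where
  \<open>P3 = P2\<close> encodes that there are only two.
\<close>

definition wy_region ::
  "wy_consts \<Rightarrow> real \<Rightarrow> real \<Rightarrow> plane \<Rightarrow> plane set \<Rightarrow> plane set \<Rightarrow> bool" where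
  "wy_region K a b Y R0 hR0 \<longleftrightarrow>
     (\<exists>\<omega>1 \<omega>2.
        wy_side K a b {I_lo K..<J_lo K} \<omega>1 \<and> wy_side K a b {J_hi K<..I_hi K} \<omega>2 \<and>
        (b > 0 \<longrightarrow>
           hR0 = closed_segment (pathstart \<omega>1) (pathstart \<omega>2) \<union>
                 closed_segment (pathfinish \<omega>1) (pathfinish \<omega>2) \<and>
           (let \<Gamma> = path_image \<omega>1 \<union> path_image \<omega>2 \<union> hR0 in R0 = \<Gamma> \<union> inside \<Gamma>)) \<and>
        (b < 0 \<longrightarrow>
           (\<exists>P1 P2 P3 \<psi> u1 u2 t1 t2.
              unstable_param (henon a b) Y \<psi> \<and>
              path_image \<omega>1 \<inter> range \<psi> = {P1, P2, P3} \<and>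
              snd P1 > snd P2 \<and> (P3 = P2 \<or> snd P2 > snd P3) \<and>
              u1 \<in> {0..1} \<and> u2 \<in> {0..1} \<and> \<omega>1 u1 = P1 \<and> \<omega>1 u2 = P2 \<and>
              \<psi> t1 = P1 \<and> \<psi> t2 = P2 \<and>
              hR0 = \<psi> ` closed_segment t1 t2 \<and>
              (let \<Gamma> = \<omega>1 ` closed_segment u1 u2 \<union> hR0 in R0 = \<Gamma> \<union> inside \<Gamma>))))"

definition cantor_set :: "plane set \<Rightarrow> bool" where
  "cantor_set C \<longleftrightarrow>
     C \<noteq> {} \<and> compact C \<and> (\<forall>p\<in>C. p islimpt C) \<and>
     (\<forall>S. S \<subseteq> C \<and> connected S \<longrightarrow> (\<exists>p. S \<subseteq> {p}))"

definition hausdorff_dist :: "plane set \<Rightarrow> plane set \<Rightarrow> real" where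
  "hausdorff_dist A B = max (SUP p\<in>A. infdist p B) (SUP q\<in>B. infdist q A)"

definition graph_over :: "real \<Rightarrow> real \<Rightarrow> (real \<Rightarrow> real) \<Rightarrow> plane set" where
  "graph_over u v f = (\<lambda>x. (x, f x)) ` {u..v}"

text \<open>The graph of the \<open>C\<^sup>2\<close> function \<open>f\<close> (derivative \<open>f'\<close>) has slopes and curvature at most \<open>m\<close>.\<close>

definition flat_graph :: "real \<Rightarrow> real \<Rightarrow> real \<Rightarrow> (real \<Rightarrow> real) \<Rightarrow> (real \<Rightarrow> real) \<Rightarrow> bool" where
  "flat_graph m u v f f' \<longleftrightarrow>
     (\<exists>f''. continuous_on {u..v} f'' \<and>
        (\<forall>x\<in>{u..v}.
           (f has_real_derivative f' x) (at x within {u..v}) \<and>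
           (f' has_real_derivative f'' x) (at x within {u..v}) \<and>
           \<bar>f' x\<bar> \<le> m \<and> \<bar>f'' x\<bar> / (1 + (f' x)\<^sup>2) powr (3 / 2) \<le> m))"

text \<open>
  \<open>Q\<close> is the region over \<open>[u, v]\<close> between the graphs of \<open>f\<close> (lower) and \<open>g\<close> (upper), its two
  horizontal boundaries. The vertical sides may or may not belong to \<open>Q\<close>: they do not for \<open>k = 0\<close>,
  where \<open>Q\<close> is given by \<open>|x| < \<delta>\<close>. \<open>hRk\<close> is the horizontal boundary of \<open>R\<^sub>k\<close>.
\<close>

definition critical_box ::
  "wy_consts \<Rightarrow> real \<Rightarrow> nat \<Rightarrow> plane set \<Rightarrow> plane set \<Rightarrow> real \<Rightarrow> real \<Rightarrow>
   (real \<Rightarrow> real) \<Rightarrow> (real \<Rightarrow> real) \<Rightarrow> (real \<Rightarrow> real) \<Rightarrow> (real \<Rightarrow> real) \<Rightarrow> bool" where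
  "critical_box K b k hRk Q u v f f' g g' \<longleftrightarrow>
     u < v \<and> (\<forall>x\<in>{u..v}. f x < g x) \<and>
     {(x, y). u < x \<and> x < v \<and> f x \<le> y \<and> y \<le> g x} \<subseteq> Q \<and>
     Q \<subseteq> {(x, y). u \<le> x \<and> x \<le> v \<and> f x \<le> y \<and> y \<le> g x} \<and>
     graph_over u v f \<subseteq> hRk \<and> graph_over u v g \<subseteq> hRk \<and>
     flat_graph (bigO K * \<bar>b\<bar>) u v f f' \<and> flat_graph (bigO K * \<bar>b\<bar>) u v g g' \<and>
     (\<forall>d\<in>{f', g'}.
        min (2 * delta K) (rho K ^ k) / bigO K \<le> integral {u..v} (\<lambda>x. sqrt (1 + (d x)\<^sup>2)) \<and>
        integral {u..v} (\<lambda>x. sqrt (1 + (d x)\<^sup>2)) \<le> bigO K * min (2 * delta K) (rho K ^ k)) \<and>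
     hausdorff_dist (graph_over u v f) (graph_over u v g) \<le> bigO K * \<bar>b\<bar> powr (real k / 2)"

definition critical_tower ::
  "wy_consts \<Rightarrow> real \<Rightarrow> (nat \<Rightarrow> plane set) \<Rightarrow> (nat \<Rightarrow> plane set) \<Rightarrow> (nat \<Rightarrow> plane set) \<Rightarrow> bool" where
  "critical_tower K b R hR Cs \<longleftrightarrow>
     Cs 0 = {p \<in> R 0. \<bar>fst p\<bar> < delta K} \<and>
     (\<forall>k. Cs (Suc k) \<subseteq> Cs k) \<and>
     (\<forall>k. finite (components (Cs k))) \<and>
     (\<forall>k. \<forall>Q\<in>components (Cs k). \<exists>u v f f' g g'.
        critical_box K b k (hR k) Q u v f f' g g' \<and>
        finite (components (Q \<inter> R (Suc k))) \<and> card (components (Q \<inter> R (Suc k))) \<le> 2 \<and>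
        (\<forall>S\<in>components (Q \<inter> R (Suc k)).
           (\<exists>p q. continuous_on {u..v} p \<and> continuous_on {u..v} q \<and>
              graph_over u v p \<subseteq> hR (Suc k) \<inter> closure Q \<and>
              graph_over u v q \<subseteq> hR (Suc k) \<inter> closure Q \<and>
              S \<subseteq> {(x, y). u \<le> x \<and> x \<le> v \<and> p x \<le> y \<and> y \<le> q x}) \<and>
           (\<exists>!Q'. Q' \<in> components (Cs (Suc k)) \<and> Q' \<subseteq> S)))"

definition horizontal_boundary ::
  "wy_consts \<Rightarrow> real \<Rightarrow> nat \<Rightarrow> plane set \<Rightarrow> plane set \<Rightarrow> real \<Rightarrow> real \<Rightarrow>
   (real \<Rightarrow> real) \<Rightarrow> (real \<Rightarrow> real) \<Rightarrow> bool" where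
  "horizontal_boundary K b k hRk Q u v f f' \<longleftrightarrow>
     (\<exists>g g'. critical_box K b k hRk Q u v f f' g g' \<or> critical_box K b k hRk Q u v g g' f f')"

text \<open>The critical point condition at \<open>z\<close> with unit tangent vector \<open>\<tau>\<close>.\<close>

definition critical_at :: "wy_consts \<Rightarrow> real \<Rightarrow> real \<Rightarrow> plane \<Rightarrow> plane \<Rightarrow> bool" where
  "critical_at K a b z \<tau> \<longleftrightarrow>
     (\<forall>j\<ge>1. norm (frechet_derivative (henon a b ^^ j) (at z) (0, 1))
              \<ge> exp (cexp K * real j) / kappa K) \<and>
     (\<forall>n\<ge>1. norm (frechet_derivative (henon a b ^^ n) (at z) \<tau>) < (kappa K * \<bar>b\<bar>) ^ n)"

definition wy_critical_set ::
  "wy_consts \<Rightarrow> real \<Rightarrow> real \<Rightarrow> plane set \<Rightarrow> plane set \<Rightarrow> plane set \<Rightarrow> bool" where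
  "wy_critical_set K a b R0 hR0 C \<longleftrightarrow>
     (let F = henon a b; R = (\<lambda>k. (F ^^ k) ` R0); hR = (\<lambda>k. (F ^^ k) ` hR0) in
      cantor_set C \<and> C \<subseteq> (\<Inter>k. R k) \<and>
      (\<exists>Cs. critical_tower K b R hR Cs \<and> C = (\<Inter>k. Cs k) \<and>
         (\<forall>k. \<forall>Q\<in>components (Cs k). \<forall>u v f f'.
            horizontal_boundary K b k (hR k) Q u v f f' \<longrightarrow>
            (\<exists>!x. x \<in> {u..v} \<and> critical_at K a b (x, f x) (sgn (1, f' x)))) \<and>
         C = {p. p islimpt
                {(x, f x) | x f f' u v Q k.
                   Q \<in> components (Cs k) \<and> horizontal_boundary K b k (hR k) Q u v f f' \<and>
                   x \<in> {u..v} \<and> critical_at K a b (x, f x) (sgn (1, f' x))}}) \<and>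
      (\<forall>z\<in>C. \<forall>j\<ge>1. infdist ((F ^^ j) z) C \<ge> exp (- (alpha K * real j)) / kappa K))"

text \<open>
  The conclusion of the Wang--Young theorem for one map, with \<open>X\<close> the fixed point in the strange
  attractor \<open>\<Inter>k. R\<^sub>k\<close>, \<open>Y\<close> the fixed point outside it, and \<open>C\<close> the critical set.
\<close>

definition wy_good :: "wy_consts \<Rightarrow> real \<Rightarrow> real \<Rightarrow> plane \<Rightarrow> plane \<Rightarrow> plane set \<Rightarrow> bool" where
  "wy_good K a b X Y C \<longleftrightarrow>
     (\<exists>R0 hR0. wy_region K a b Y R0 hR0 \<and>
        {p. henon a b p = p} = {X, Y} \<and>
        X \<in> (\<Inter>k. (henon a b ^^ k) ` R0) \<and> Y \<notin> (\<Inter>k. (henon a b ^^ k) ` R0) \<and>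
        wy_critical_set K a b R0 hR0 C)"

text \<open>
  \<open>wy_package astar s \<epsilon> K \<Delta>\<close>: \<open>\<Delta>\<close> is a set of good parameters \<open>(a, b)\<close>, with \<open>s \<in> {1, -1}\<close> the sign
  of \<open>b\<close>, as provided by the Wang--Young theorem in a rectangle near \<open>(astar, 0)\<close>. The number \<open>\<epsilon>\<close>
  quantifies both the closeness and how much smaller \<open>b\<close> is than the constants.
\<close>

definition wy_package ::
  "real \<Rightarrow> real \<Rightarrow> real \<Rightarrow> wy_consts \<Rightarrow> (real \<times> real) set \<Rightarrow> bool" where
  "wy_package astar s \<epsilon> K \<Delta> \<longleftrightarrow>
     I_lo K < J_lo K \<and> J_lo K < J_hi K \<and> J_hi K < I_hi K \<and>
     kappa K > 0 \<and> alpha K > 0 \<and> delta K > 0 \<and> cexp K > 0 \<and> 0 < rho K \<and> rho K < 1 \<and>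
     bigO K > 0 \<and>
     (\<exists>a0 a1 b0.
        a0 < a1 \<and> 0 < b0 \<and> {a0..a1} \<times> {0..b0} \<subseteq> ball (astar, 0) \<epsilon> \<and>
        b0 < \<epsilon> * Min {alpha K, delta K, rho K, exp (- cexp K)} \<and>
        (\<forall>a\<in>{a0..a1}. quad a ` {I_lo K..I_hi K} \<subseteq> {J_lo K<..<J_hi K}) \<and>
        (\<forall>a\<in>{a0..a1}. \<forall>b. 0 < s * b \<and> s * b \<le> b0 \<longrightarrow>
           henon a b ` rect_R K b \<subseteq>
             interior ({J_lo K..J_hi K} \<times> {- (kappa K * \<bar>b\<bar>)..kappa K * \<bar>b\<bar>})) \<and>
        \<Delta> \<subseteq> {(a, b). a \<in> {a0..a1} \<and> 0 < s * b \<and> s * b \<le> b0} \<and>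
        emeasure lebesgue \<Delta> > 0 \<and>
        (\<exists>\<beta>>0. \<forall>b. 0 < s * b \<and> s * b < \<beta> \<longrightarrow> emeasure lebesgue {a. (a, b) \<in> \<Delta>} > 0) \<and>
        (\<forall>(a, b)\<in>\<Delta>. \<exists>X Y C. wy_good K a b X Y C))"

text \<open>
  \<open>(a, b)\<close> is a Wang--Young parameter, \<open>X\<close> is the fixed point in the strange attractor, and \<open>C\<close> is
  the critical set. ``Much smaller'' and ``near'' have no numerical meaning for a single rectangle; there
  they are read in the weakest way, \<open>\<epsilon> = 1\<close>, while such rectangles exist for arbitrarily small \<open>\<epsilon>\<close>.
\<close>

definition wy_henon :: "real \<Rightarrow> real \<Rightarrow> plane \<Rightarrow> plane set \<Rightarrow> bool" where
  "wy_henon a b X C \<longleftrightarrow>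
     (\<exists>astar\<in>{1.5..2}. \<exists>s\<in>{1, -1}.
        misiurewicz astar \<and>
        (\<forall>\<epsilon>>0. \<exists>K \<Delta>. wy_package astar s \<epsilon> K \<Delta>) \<and>
        (\<exists>K \<Delta> Y. wy_package astar s 1 K \<Delta> \<and> (a, b) \<in> \<Delta> \<and> wy_good K a b X Y C))"


section \<open>The folding pattern\<close>

definition basic_critical :: "(plane \<Rightarrow> plane) \<Rightarrow> plane \<Rightarrow> plane set \<Rightarrow> plane set" where
  "basic_critical F X C = C \<inter> unstable_set F X"

definition basic_points :: "(plane \<Rightarrow> plane) \<Rightarrow> plane \<Rightarrow> plane set \<Rightarrow> plane set" where
  "basic_points F X C = (\<Union>n. (F ^^ n) ` basic_critical F X C)"

text \<open>
  \<open>\<phi>\<close> is a parametrization of \<open>W\<^sup>u\<close> that takes the nonzero integers to the basic points. The last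
  four clauses say that \<open>\<phi> (-1)\<close> is \<open>z\<^sub>0\<close>, the first basic critical point on \<open>W\<^sup>u\<close> to the left
  of \<open>X\<close>, and that \<open>\<phi> 1\<close> is its image; then \<open>X = \<phi> 0\<close> lies between them. Consequently \<open>\<phi> ` {..0}\<close>
  and \<open>\<phi> ` {0..}\<close> are the two halves of \<open>W\<^sup>u\<close>, the first one containing \<open>z\<^sub>0\<close>.
\<close>

definition folding_param ::
  "(plane \<Rightarrow> plane) \<Rightarrow> plane \<Rightarrow> plane set \<Rightarrow> (real \<Rightarrow> plane) \<Rightarrow> bool" where
  "folding_param F X C \<phi> \<longleftrightarrow>
     unstable_param F X \<phi> \<and>
     \<phi> ` real_of_int ` (UNIV - {0}) = basic_points F X C \<and>
     (\<forall>\<^sub>F t in at_left 0. fst (\<phi> t) < fst X) \<and>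
     \<phi> (- 1) \<in> basic_critical F X C \<and>
     (\<forall>t\<in>{-1<..<0}. \<phi> t \<notin> basic_critical F X C) \<and>
     \<phi> 1 = F (\<phi> (- 1))"

text \<open>
  The basic points are indexed by the nonzero integers; those that are not in \<open>basic_critical\<close> are
  in \<open>F\<^sup>n (basic_critical)\<close> for some \<open>n \<ge> 1\<close>, and these two classes are disjoint.
\<close>

definition folding_pattern ::
  "(plane \<Rightarrow> plane) \<Rightarrow> plane \<Rightarrow> plane set \<Rightarrow> (real \<Rightarrow> plane) \<Rightarrow> int \<Rightarrow> nat" where
  "folding_pattern F X C \<phi> =
     (\<lambda>k\<in>UNIV - {0}. if \<phi> (real_of_int k) \<in> basic_critical F X C then 0 else 1)"


section \<open>The pruned tree\<close>

definition basic_arc ::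
  "(plane \<Rightarrow> plane) \<Rightarrow> plane \<Rightarrow> plane set \<Rightarrow> (real \<Rightarrow> plane) \<Rightarrow> plane set \<Rightarrow> bool" where
  "basic_arc F X C \<phi> A \<longleftrightarrow>
     (\<exists>s t. s < t \<and> A = \<phi> ` {s..t} \<and> \<phi> s \<in> basic_points F X C \<and> \<phi> t \<in> basic_points F X C \<and>
        (\<forall>r\<in>{s<..<t}. \<phi> r \<notin> basic_points F X C))"

definition basic_arc_indexing ::
  "(plane \<Rightarrow> plane) \<Rightarrow> plane \<Rightarrow> plane set \<Rightarrow> (real \<Rightarrow> plane) \<Rightarrow> (int \<Rightarrow> plane set) \<Rightarrow> bool" where
  "basic_arc_indexing F X C \<phi> I \<longleftrightarrow>
     range I = {A. basic_arc F X C \<phi> A} \<and>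
     I 0 = \<phi> ` {-1..1} \<and>
     (\<forall>n\<ge>1. I n \<subseteq> \<phi> ` {0..} \<and> I (- n) \<subseteq> \<phi> ` {..0}) \<and>
     (\<forall>i j. I i \<inter> I j \<noteq> {} \<longleftrightarrow> \<bar>i - j\<bar> \<le> 1)"

definition pruned_tree :: "(plane \<Rightarrow> plane) \<Rightarrow> (int \<Rightarrow> plane set) \<Rightarrow> int \<Rightarrow> int \<Rightarrow> bool" where
  "pruned_tree F I i j \<longleftrightarrow> I j \<subseteq> F ` I i"

text \<open>
  Apart from the loop, \<open>0 \<rightarrow> -1\<close> is the only arrow of a pruned tree that starts at \<open>0\<close>. Hence the
  vertex \<open>i\<close> in the definition is \<open>-1\<close>, and level \<open>n + 1\<close> consists of the endpoints of the paths
  with \<open>n\<close> arrows from \<open>-1\<close>; see \<open>tree_level_Suc_root\<close>.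
\<close>

fun tree_level :: "(int \<Rightarrow> int \<Rightarrow> bool) \<Rightarrow> nat \<Rightarrow> int set" where
  "tree_level T 0 = {0}"
| "tree_level T (Suc n) = {j. \<exists>i. i \<noteq> 0 \<and> T 0 i \<and> (T ^^ n) i j}"

lemma tree_level_Suc_root:
  assumes "\<And>i. T 0 i \<longleftrightarrow> i = 0 \<or> i = -1"
  shows "tree_level T (Suc n) = {j. (T ^^ n) (-1) j}"
proof -
  have "i \<noteq> 0 \<and> T 0 i \<longleftrightarrow> i = -1" for i
    using assms[of i] by auto
  then show ?thesis by (simp add: conj_assoc[symmetric])
qed

lemma tree_level_1:
  assumes "\<And>i. T 0 i \<longleftrightarrow> i = 0 \<or> i = -1"
  shows "tree_level T 1 = {-1}"
  using tree_level_Suc_root[of T 0, OF assms] by auto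

text \<open>
  Equality of pruned trees as planar graphs without the numbers. On each level \<open>n \<ge> 1\<close> the
  left-to-right order is the order by increasing modulus.
\<close>

definition same_pruned_tree :: "(int \<Rightarrow> int \<Rightarrow> bool) \<Rightarrow> (int \<Rightarrow> int \<Rightarrow> bool) \<Rightarrow> bool" where
  "same_pruned_tree T T' \<longleftrightarrow>
     (\<exists>\<sigma>. bij \<sigma> \<and>
        (\<forall>i j. T i j \<longleftrightarrow> T' (\<sigma> i) (\<sigma> j)) \<and>
        (\<forall>n i. i \<in> tree_level T n \<longleftrightarrow> \<sigma> i \<in> tree_level T' n) \<and>
        (\<forall>n\<ge>1. \<forall>i\<in>tree_level T n. \<forall>j\<in>tree_level T n. \<bar>i\<bar> < \<bar>j\<bar> \<longleftrightarrow> \<bar>\<sigma> i\<bar> < \<bar>\<sigma> j\<bar>))"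

end

theory Submission
  imports Defs
begin

text \<open>
  Let \<open>h\<close> be the homeomorphism of the parameter line that represents the action of the Henon map on
  \<open>W\<^sup>u\<close>. It is decreasing, fixes \<open>0\<close> and maps integers to integers, hence restricts to a
  decreasing map \<open>H\<close> of the integers. A basic point lies outside the critical set iff it is the
  image of a basic point, so the folding pattern is the indicator function of the range of \<open>H\<close>, and
  it determines \<open>H\<close> because \<open>H\<close> is monotone and fixes \<open>0\<close>. On the other hand, the children of a
  vertex \<open>i\<close> form an interval of integers between consecutive values of \<open>H\<close>, so the numbered tree
  also determines \<open>H\<close>. It remains to recover the numbers: the levels of odd (even) index cut the
  negative (positive) integers into consecutive intervals with endpoints \<open>H\<^sup>n (-1)\<close>, so their
  cardinalities determine them one after the other, and on each level an isomorphism is a monotone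
  self-bijection of a finite interval, hence the identity.
\<close>

section \<open>Monotone maps of the integers\<close>

text \<open>Counting up from the left end bounds \<open>f x\<close> from below, counting down from
  the right end bounds it from above.\<close>

lemma strict_mono_on_interval_eq_id:
  fixes f :: "int \<Rightarrow> int"
  assumes mono: "\<And>x y. x \<in> {a..<b} \<Longrightarrow> y \<in> {a..<b} \<Longrightarrow> x < y \<Longrightarrow> f x < f y"
    and maps: "\<And>x. x \<in> {a..<b} \<Longrightarrow> f x \<in> {a..<b}"
    and x: "x \<in> {a..<b}"
  shows "f x = x"
proof -
  have ge: "a + int n < b \<Longrightarrow> a + int n \<le> f (a + int n)" for n
  proof (induction n)
    case 0
    then show ?case using maps[of a] by auto
  next
    case (Suc n)
    then show ?case using mono[of "a + int n" "a + int (Suc n)"] by auto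
  qed
  have le: "a \<le> b - 1 - int n \<Longrightarrow> f (b - 1 - int n) \<le> b - 1 - int n" for n
  proof (induction n)
    case 0
    then show ?case using maps[of "b - 1"] by auto
  next
    case (Suc n)
    then show ?case using mono[of "b - 1 - int (Suc n)" "b - 1 - int n"] by auto
  qed
  show ?thesis using ge[of "nat (x - a)"] le[of "nat (b - 1 - x)"] x by auto
qed

lemma strict_mono_bij_int_eq_id:
  fixes f :: "int \<Rightarrow> int"
  assumes mono: "strict_mono f" and surj: "surj f" and zero: "f 0 = 0"
  shows "f n = n"
proof -
  have step: "f (k + 1) = f k + 1" for k
  proof -
    \<comment> \<open>Surjectivity excludes gaps: the value \<open>f k + 1\<close> is taken at some
      \<open>m > k\<close>.\<close>
    obtain m where m: "f m = f k + 1" using surj by (metis surjD)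
    then have "k < m" using strict_mono_less[OF mono, of k m] by simp
    then have "f (k + 1) \<le> f m" using strict_mono_less_eq[OF mono, of "k + 1" m] by simp
    moreover have "f k < f (k + 1)" using mono by (simp add: strict_mono_less)
    ultimately show ?thesis using m by simp
  qed
  show ?thesis
  proof (induction n rule: int_induct[of _ 0])
    case (step2 i)
    then show ?case using step[of "i - 1"] by simp
  qed (simp_all add: zero step)
qed

text \<open>The reparametrization \<open>u\<close> with \<open>f (u n) = g n\<close> is an
  increasing bijection of the integers fixing 0, hence the identity.\<close>

lemma strict_antimono_int_eqI:
  fixes f g :: "int \<Rightarrow> int"
  assumes f: "\<And>i j. i < j \<Longrightarrow> f j < f i" and g: "\<And>i j. i < j \<Longrightarrow> g j < g i"
    and zero: "f 0 = 0" "g 0 = 0" and range: "range f = range g"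
  shows "f = g"
proof -
  have "\<forall>n. \<exists>m. f m = g n" using range by (metis rangeE rangeI)
  then obtain u where u: "f (u n) = g n" for n by metis
  have f_less: "f j < f i \<longleftrightarrow> i < j" and f_inj: "f i = f j \<Longrightarrow> i = j" for i j
    using f[of i j] f[of j i] by (cases i j rule: linorder_cases; simp)+
  have "strict_mono u"
  proof (rule strict_monoI)
    fix i j :: int
    assume "i < j"
    then have "f (u j) < f (u i)" using g u by simp
    then show "u i < u j" using f_less by simp
  qed
  moreover have "surj u"
  proof (unfold surj_def, intro allI)
    fix y
    have "f y \<in> range g" using range by blast
    then obtain n where "f y = f (u n)" using u by auto
    then show "\<exists>n. y = u n" using f_inj by blast
  qed
  moreover have "u 0 = 0" using u[of 0] zero f_inj by simp
  ultimately have "u n = n" for n by (rule strict_mono_bij_int_eq_id)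
  then show ?thesis using u by (intro ext) simp
qed

text \<open>A tiling: for \<open>w\<close> the action on moduli, the pieces are the sets of children
  of consecutive vertices.\<close>

lemma strict_mono_between_iff:
  fixes w :: "int \<Rightarrow> int"
  assumes w: "strict_mono w" and "a \<le> b"
  shows "(\<exists>m\<in>{a..<b}. w m \<le> x \<and> x < w (m + 1)) \<longleftrightarrow> w a \<le> x \<and> x < w b"
proof -
  have "x < w (a + int n) \<Longrightarrow> w a \<le> x \<Longrightarrow> \<exists>m\<in>{a..<a + int n}. w m \<le> x \<and> x < w (m + 1)" for n
  proof (induction n)
    case (Suc n)
    show ?case
    proof (cases "x < w (a + int n)")
      case True
      then obtain m where "m \<in> {a..<a + int n}" "w m \<le> x \<and> x < w (m + 1)" using Suc by blast
      then show ?thesis by (intro bexI[of _ m]) auto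
    next
      case False
      moreover have "x < w (a + int n + 1)" using Suc.prems(1) by (simp add: add.commute add.left_commute)
      ultimately show ?thesis by (intro bexI[of _ "a + int n"]) auto
    qed
  qed simp
  from this[of "nat (b - a)"]
  have "w a \<le> x \<Longrightarrow> x < w b \<Longrightarrow> \<exists>m\<in>{a..<b}. w m \<le> x \<and> x < w (m + 1)"
    by (simp only: int_nat_eq) (simp add: assms(2))
  moreover have "w a \<le> x \<and> x < w b" if "m \<in> {a..<b}" "w m \<le> x" "x < w (m + 1)" for m
    using that strict_mono_less_eq[OF w, of a m] strict_mono_less_eq[OF w, of "m + 1" b] by auto
  ultimately show ?thesis by blast
qed


lemma minus_one_power_cases: "(- 1) ^ n = (1::int) \<or> (- 1) ^ n = (- 1 :: int)"
  by (cases "even n") auto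


section \<open>The action on the indices of the basic points\<close>

text \<open>\<open>H\<close> is the Henon map on the indices of the basic points, with 0 standing
  for X. In \<open>H_m1\<close>, index 1 is the image of z_0; \<open>H_1\<close> reflects that z_0,
  of index -1, is not the image of a basic point.\<close>

locale basic_action =
  fixes H :: "int \<Rightarrow> int"
  assumes anti: "i < j \<Longrightarrow> H j < H i"
    and H_0: "H 0 = 0" and H_m1: "H (- 1) = 1" and H_1: "H 1 < - 1"

definition range_pattern :: "(int \<Rightarrow> int) \<Rightarrow> int \<Rightarrow> nat" where
  "range_pattern H = (\<lambda>k\<in>UNIV - {0}. if k \<in> range H then 1 else 0)"

text \<open>The arc with index \<open>i\<close> is \<open>\<phi> ` {arc_lo i..arc_hi i}\<close>, since \<open>0\<close> is not the index of a basic point.\<close>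

definition arc_lo :: "int \<Rightarrow> int" where "arc_lo i = (if i \<le> 0 then i - 1 else i)"

definition arc_hi :: "int \<Rightarrow> int" where "arc_hi i = (if i \<ge> 0 then i + 1 else i)"

text \<open>A decreasing map swaps the ends of an arc; the image of arc \<open>i\<close> is required
  to contain arc \<open>j\<close>.\<close>

definition arrow :: "(int \<Rightarrow> int) \<Rightarrow> int \<Rightarrow> int \<Rightarrow> bool" where
  "arrow H i j \<longleftrightarrow> H (arc_hi i) \<le> arc_lo j \<and> arc_hi j \<le> H (arc_lo i)"

context basic_action
begin

section \<open>Children of a vertex\<close>

lemma H_less_iff: "H i < H j \<longleftrightarrow> j < i"
  using anti[of i j] anti[of j i] by (cases i j rule: linorder_cases) auto

lemma H_pos_iff: "0 < H i \<longleftrightarrow> i < 0" and H_neg_iff: "H i < 0 \<longleftrightarrow> 0 < i"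
  using H_less_iff[of 0 i] H_less_iff[of i 0] H_0 by auto

text \<open>The image of the arc around X ends at 1 on the positive side, so besides arc 0 it covers
  only arcs of negative index.\<close>

lemma arrow_0: "arrow H 0 j \<longleftrightarrow> H 1 < j \<and> j \<le> 0"
  using H_m1 H_1 by (auto simp: arrow_def arc_lo_def arc_hi_def)

text \<open>The sign \<open>s\<close> is that of \<open>i\<close>; the children have the opposite sign.\<close>

lemma arrow_iff:
  assumes "s = 1 \<or> s = - 1" and "0 < s * i"
  shows "arrow H i j \<longleftrightarrow> - s * H i \<le> - s * j \<and> - s * j < - s * H (i + s)"
  using assms(1)
proof
  assume "s = 1"
  then show ?thesis
    using assms(2) H_neg_iff[of i] by (cases "j < 0") (auto simp: arrow_def arc_lo_def arc_hi_def)
next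
  assume "s = - 1"
  then show ?thesis
    using assms(2) H_pos_iff[of i] by (cases "0 < j") (auto simp: arrow_def arc_lo_def arc_hi_def)
qed

section \<open>Levels of the tree as intervals of moduli\<close>

text \<open>The modulus of the iterate \<open>H\<^sup>n (-1)\<close>, which has sign \<open>(-1)\<^sup>n\<^sup>+\<^sup>1\<close>.\<close>

definition level_start :: "nat \<Rightarrow> int" where
  "level_start n = (- 1) ^ Suc n * (H ^^ n) (- 1)"

lemma level_start_0: "level_start 0 = 1" and level_start_1: "level_start (Suc 0) = 1"
  by (simp_all add: level_start_def H_m1)

lemma funpow_eq_level_start: "(H ^^ n) (- 1) = (- 1) ^ Suc n * level_start n"
  unfolding level_start_def by (cases "even n") auto

lemma level_start_Suc:
  "level_start (Suc n) = - ((- 1) ^ Suc n) * H ((- 1) ^ Suc n * level_start n)"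
  by (simp add: level_start_def[of "Suc n"] funpow_eq_level_start[of n])

text \<open>Measured by modulus, from sign \<open>s\<close> to sign \<open>- s\<close>, the
  decreasing \<open>H\<close> becomes increasing. This treats both halves at once.\<close>

lemma strict_mono_signed:
  assumes "s = 1 \<or> s = - 1"
  shows "strict_mono (\<lambda>m. - s * H (s * m))"
  using assms by (auto intro!: strict_monoI anti)

text \<open>The base case is \<open>1 < - H 1\<close>. Starts two apart have equal signs, so one
  increasing map carries both to the next pair.\<close>

lemma level_start_less: "level_start n < level_start (Suc (Suc n))"
proof (induction n)
  case 0
  show ?case by (simp add: level_start_def H_m1) (use H_1 in simp)
next
  case (Suc n)
  let ?s = "(- 1) ^ Suc n :: int"
  have "- ?s * H (?s * level_start n) < - ?s * H (?s * level_start (Suc (Suc n)))"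
    by (rule strict_monoD[OF strict_mono_signed[OF minus_one_power_cases] Suc])
  then show ?case by (simp add: level_start_Suc[of n] level_start_Suc[of "Suc (Suc n)"])
qed

lemma level_start_pos: "0 < level_start n"
proof (induction n rule: induct_nat_012)
  case (ge2 n)
  then show ?case using level_start_less[of n] by linarith
qed (simp_all add: level_start_0 level_start_1)

lemma tree_level_arrow_step:
  "tree_level T (Suc (Suc n)) = {j. \<exists>i\<in>tree_level T (Suc n). T i j}"
  by auto

text \<open>On moduli the children of \<open>m\<close> fill the interval from \<open>w m\<close> to
  \<open>w (m + 1)\<close>, so those of a whole level tile the interval between the images of its
  ends.\<close>

lemma tree_level_arrow:
  "tree_level (arrow H) (Suc n) =
     {j. level_start n \<le> (- 1) ^ Suc n * j \<and> (- 1) ^ Suc n * j < level_start (Suc (Suc n))}"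
proof (induction n)
  case 0
  have "level_start (Suc (Suc 0)) = - H 1" by (simp add: level_start_def H_m1)
  then show ?case by (auto simp: arrow_0 level_start_0)
next
  case (Suc n)
  define s :: int where "s = (- 1) ^ Suc n"
  have s: "s = 1 \<or> s = - 1" unfolding s_def by (rule minus_one_power_cases)
  then have ss: "s * (s * m) = m" for m by auto
  have Suc': "- ((- 1) ^ Suc n) = ((- 1) ^ Suc (Suc n) :: int)" by simp
  define A where "A = {level_start n..<level_start (Suc (Suc n))}"
  define w where "w m = - s * H (s * m)" for m
  have w: "strict_mono w" unfolding w_def by (rule strict_mono_signed[OF s])
  have start: "w (level_start n) = level_start (Suc n)"
      "w (level_start (Suc (Suc n))) = level_start (Suc (Suc (Suc n)))"
    by (simp_all add: w_def s_def level_start_Suc[of n] level_start_Suc[of "Suc (Suc n)"])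
  have arrow: "arrow H (s * m) j \<longleftrightarrow> w m \<le> - s * j \<and> - s * j < w (m + 1)" if "0 < m" for m j
  proof -
    have "s * m + s = s * (m + 1)" by (simp add: distrib_left)
    then show ?thesis using arrow_iff[OF s, of "s * m" j] that by (simp only: ss w_def)
  qed
  have IH: "i \<in> tree_level (arrow H) (Suc n) \<longleftrightarrow> s * i \<in> A" for i
    unfolding Suc.IH A_def s_def by (simp only: mem_Collect_eq atLeastLessThan_iff)
  have "j \<in> tree_level (arrow H) (Suc (Suc n)) \<longleftrightarrow>
      level_start (Suc n) \<le> - s * j \<and> - s * j < level_start (Suc (Suc (Suc n)))" for j
  proof -
    have "j \<in> tree_level (arrow H) (Suc (Suc n)) \<longleftrightarrow> (\<exists>i. s * i \<in> A \<and> arrow H i j)"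
      by (simp only: tree_level_arrow_step mem_Collect_eq Bex_def IH)
    also have "\<dots> \<longleftrightarrow> (\<exists>m\<in>A. arrow H (s * m) j)"
    proof
      assume "\<exists>i. s * i \<in> A \<and> arrow H i j"
      then obtain i where "s * i \<in> A" "arrow H i j" by blast
      then show "\<exists>m\<in>A. arrow H (s * m) j" by (intro bexI[of _ "s * i"]) (simp_all only: ss)
    next
      assume "\<exists>m\<in>A. arrow H (s * m) j"
      then obtain m where "m \<in> A" "arrow H (s * m) j" by blast
      then show "\<exists>i. s * i \<in> A \<and> arrow H i j" by (intro exI[of _ "s * m"]) (simp only: ss)
    qed
    also have "\<dots> \<longleftrightarrow> (\<exists>m\<in>A. w m \<le> - s * j \<and> - s * j < w (m + 1))"
      by (rule bex_cong[OF refl], rule arrow)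
        (use level_start_pos[of n] in \<open>simp add: A_def\<close>)
    also have "\<dots> \<longleftrightarrow> w (level_start n) \<le> - s * j \<and> - s * j < w (level_start (Suc (Suc n)))"
      unfolding A_def by (rule strict_mono_between_iff[OF w less_imp_le[OF level_start_less]])
    finally show ?thesis unfolding start .
  qed
  then show ?case unfolding s_def Suc' by (intro set_eqI) (simp only: mem_Collect_eq)
qed

text \<open>Cardinalities are invariant under isomorphism, so this lets the starts be recovered
  recursively from the first two.\<close>

lemma card_tree_level:
  "int (card (tree_level (arrow H) (Suc n))) = level_start (Suc (Suc n)) - level_start n"
proof -
  define s :: int where "s = (- 1) ^ Suc n"
  have "s = 1 \<or> s = - 1" unfolding s_def by (rule minus_one_power_cases)
  then have ss: "s * (s * m) = m" for m by auto
  have "bij_betw ((*) s) (tree_level (arrow H) (Suc n)) {level_start n..<level_start (Suc (Suc n))}"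
    unfolding tree_level_arrow s_def[symmetric]
    by (rule bij_betw_byWitness[of _ "(*) s"]) (auto simp: ss)
  then have "card (tree_level (arrow H) (Suc n)) = card {level_start n..<level_start (Suc (Suc n))}"
    by (rule bij_betw_same_card)
  then show ?thesis using level_start_less[of n] by simp
qed

text \<open>Levels of equal parity abut and their starts grow without bound, so they exhaust the
  integers of one sign.\<close>

lemma in_some_tree_level:
  assumes "i \<noteq> 0"
  shows "\<exists>n. i \<in> tree_level (arrow H) (Suc n)"
proof -
  \<comment> \<open>Level \<open>n + 1\<close> is negative for even \<open>n\<close> and positive
    for odd \<open>n\<close>; \<open>r\<close> is the required parity.\<close>
  define r :: nat where "r = (if i < 0 then 0 else 1)"
  have "\<bar>i\<bar> < level_start (r + 2 * k) \<Longrightarrow>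
      \<exists>l. level_start (r + 2 * l) \<le> \<bar>i\<bar> \<and> \<bar>i\<bar> < level_start (Suc (Suc (r + 2 * l)))" for k
  proof (induction k)
    case 0
    then show ?case using assms by (auto simp: r_def level_start_0 level_start_1 split: if_splits)
  next
    case (Suc k)
    then show ?case by (cases "\<bar>i\<bar> < level_start (r + 2 * k)") (auto intro: exI[of _ k])
  qed
  moreover have "int k < level_start (r + 2 * k)" for k
  proof (induction k)
    case 0
    show ?case using level_start_pos by simp
  next
    case (Suc k)
    then show ?case using level_start_less[of "r + 2 * k"] by simp
  qed
  from this[of "nat \<bar>i\<bar>"] have "\<bar>i\<bar> < level_start (r + 2 * nat \<bar>i\<bar>)" by simp
  ultimately obtain l where
    "level_start (r + 2 * l) \<le> \<bar>i\<bar>" "\<bar>i\<bar> < level_start (Suc (Suc (r + 2 * l)))" by blast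
  moreover have "(- 1) ^ Suc (r + 2 * l) * i = \<bar>i\<bar>" by (simp add: r_def)
  ultimately show ?thesis unfolding tree_level_arrow by (intro exI[of _ "r + 2 * l"]) simp
qed

end


section \<open>Pattern and tree determine the action\<close>

lemma range_pattern_inject:
  assumes "basic_action H" "basic_action H'" and eq: "range_pattern H = range_pattern H'"
  shows "H = H'"
proof -
  interpret H: basic_action H by fact
  interpret H': basic_action H' by fact
  have "k \<in> range H \<longleftrightarrow> k \<in> range H'" for k
  proof (cases "k = 0")
    case True
    then show ?thesis using H.H_0 H'.H_0 by (metis rangeI)
  next
    case False
    then show ?thesis using fun_cong[OF eq, of k] by (auto simp: range_pattern_def split: if_splits)
  qed
  then show ?thesis
    by (intro strict_antimono_int_eqI H.anti H'.anti H.H_0 H'.H_0) auto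
qed

text \<open>For nonzero \<open>i\<close>, the child of least modulus is \<open>H i\<close>.\<close>

lemma arrow_inject:
  assumes "basic_action H" "basic_action H'" and eq: "arrow H = arrow H'"
  shows "H = H'"
proof
  fix i
  interpret H: basic_action H by fact
  interpret H': basic_action H' by fact
  show "H i = H' i"
  proof (cases "i = 0")
    case True
    then show ?thesis using H.H_0 H'.H_0 by simp
  next
    case False
    define s where "s = sgn i"
    have s: "s = 1 \<or> s = - 1" "0 < s * i" using False by (auto simp: s_def sgn_if)
    have "- s * H i < - s * H (i + s)" "- s * H' i < - s * H' (i + s)"
      using s H.H_less_iff H'.H_less_iff by auto
    then have "arrow H i (H i)" "arrow H' i (H' i)"
      using H.arrow_iff[OF s] H'.arrow_iff[OF s] by auto
    then have "- s * H i \<le> - s * H' i" "- s * H' i \<le> - s * H i"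
      using H.arrow_iff[OF s] H'.arrow_iff[OF s] eq by metis+
    then show ?thesis using s by auto
  qed
qed

lemma same_pruned_tree_imp_arrow_eq:
  assumes "basic_action H" "basic_action H'" and same: "same_pruned_tree (arrow H) (arrow H')"
  shows "arrow H = arrow H'"
proof -
  interpret H: basic_action H by fact
  interpret H': basic_action H' by fact
  obtain \<sigma> where bij: "bij \<sigma>"
    and arrow: "\<And>i j. arrow H i j \<longleftrightarrow> arrow H' (\<sigma> i) (\<sigma> j)"
    and level: "\<And>n i. i \<in> tree_level (arrow H) n \<longleftrightarrow> \<sigma> i \<in> tree_level (arrow H') n"
    and order: "\<And>n i j. n \<ge> 1 \<Longrightarrow> i \<in> tree_level (arrow H) n \<Longrightarrow> j \<in> tree_level (arrow H) n \<Longrightarrow>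
      \<bar>i\<bar> < \<bar>j\<bar> \<longleftrightarrow> \<bar>\<sigma> i\<bar> < \<bar>\<sigma> j\<bar>"
    using same unfolding same_pruned_tree_def by blast
  have card: "card (tree_level (arrow H) n) = card (tree_level (arrow H') n)" for n
  proof (rule bij_betw_same_card[of \<sigma>])
    have "tree_level (arrow H) n = \<sigma> -` tree_level (arrow H') n" using level by auto
    then have "\<sigma> ` tree_level (arrow H) n = tree_level (arrow H') n"
      using bij by (simp add: bij_is_surj surj_image_vimage_eq)
    then show "bij_betw \<sigma> (tree_level (arrow H) n) (tree_level (arrow H') n)"
      using bij by (auto simp: bij_betw_def intro: inj_on_subset)
  qed
  have diff: "H.level_start (Suc (Suc n)) - H.level_start n =
      H'.level_start (Suc (Suc n)) - H'.level_start n" for n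
    by (simp only: H.card_tree_level[symmetric] H'.card_tree_level[symmetric] card)
  \<comment> \<open>Both sequences begin with 1, 1 and have the same differences at distance
    two.\<close>
  have start: "H.level_start n = H'.level_start n" for n
  proof (induction n rule: induct_nat_012)
    case (ge2 n)
    then show ?case using diff[of n] by simp
  qed (simp_all add: H.level_start_0 H.level_start_1 H'.level_start_0 H'.level_start_1)
  have "\<sigma> i = i" for i
  proof (cases "i = 0")
    case True
    then show ?thesis using level[of 0 0] by simp
  next
    case False
    then obtain n where n: "i \<in> tree_level (arrow H) (Suc n)" using H.in_some_tree_level by blast
    define s :: int where "s = (- 1) ^ Suc n"
    have s: "s = 1 \<or> s = - 1" unfolding s_def by (rule minus_one_power_cases)
    then have ss: "s * (s * m) = m" for m by auto
    define A where "A = {H.level_start n..<H.level_start (Suc (Suc n))}"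
    have mem: "j \<in> tree_level (arrow H) (Suc n) \<longleftrightarrow> s * j \<in> A"
      "j \<in> tree_level (arrow H') (Suc n) \<longleftrightarrow> s * j \<in> A" for j
      unfolding H.tree_level_arrow H'.tree_level_arrow start s_def A_def by auto
    have maps: "s * \<sigma> (s * m) \<in> A" if "m \<in> A" for m
      using that level[of "s * m" "Suc n"] by (simp only: mem ss)
    have abs: "\<bar>j\<bar> = s * j" if "s * j \<in> A" for j
      using that s H.level_start_pos[of n] by (auto simp: A_def)
    \<comment> \<open>Conjugation by the sign turns \<open>\<sigma>\<close> on this level into an
      increasing self-map of \<open>A\<close>.\<close>
    have "s * \<sigma> (s * (s * i)) = s * i"
    proof (rule strict_mono_on_interval_eq_id[where f = "\<lambda>m. s * \<sigma> (s * m)" and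
          a = "H.level_start n" and b = "H.level_start (Suc (Suc n))", folded A_def])
      fix x y assume xy: "x \<in> A" "y \<in> A" "x < y"
      have "\<bar>s * x\<bar> < \<bar>s * y\<bar> \<longleftrightarrow> \<bar>\<sigma> (s * x)\<bar> < \<bar>\<sigma> (s * y)\<bar>"
        using xy order[of "Suc n" "s * x" "s * y"] by (simp only: mem ss)
      then show "s * \<sigma> (s * x) < s * \<sigma> (s * y)" using abs maps xy ss by simp
    qed (use maps n mem in simp_all)
    then show ?thesis by (metis ss)
  qed
  then show ?thesis using arrow by (intro ext) simp
qed

lemma same_pruned_tree_refl: "same_pruned_tree T T"
  unfolding same_pruned_tree_def by (rule exI[of _ id]) auto

lemma pattern_eq_iff_same_pruned_tree:
  assumes "basic_action H" "basic_action H'"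
  shows "range_pattern H = range_pattern H' \<longleftrightarrow> same_pruned_tree (arrow H) (arrow H')"
  using range_pattern_inject[OF assms] arrow_inject[OF assms]
    same_pruned_tree_imp_arrow_eq[OF assms] same_pruned_tree_refl by metis


section \<open>The action of a Henon map on its unstable manifold\<close>

text \<open>The last claim holds because a point of \<open>C\<close> has distance 0 from
  \<open>C\<close>, while the distance along a critical orbit has a positive lower bound.\<close>

lemma wy_henonD:
  assumes "wy_henon a b X C"
  shows "b \<noteq> 0" and "henon a b X = X" and "z \<in> C \<Longrightarrow> j \<ge> 1 \<Longrightarrow> (henon a b ^^ j) z \<notin> C"
proof -
  obtain astar s K \<Delta> Y where wy: "wy_package astar s 1 K \<Delta>" "(a, b) \<in> \<Delta>" "wy_good K a b X Y C"
    using assms unfolding wy_henon_def by blast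
  from wy(1) obtain a0 a1 b0 where "\<Delta> \<subseteq> {(a, b). a \<in> {a0..a1} \<and> 0 < s * b \<and> s * b \<le> b0}"
    and kappa: "kappa K > 0"
    unfolding wy_package_def by blast
  with wy(2) show "b \<noteq> 0" by auto
  show "henon a b X = X" using wy(3) unfolding wy_good_def by blast
  have "\<forall>z\<in>C. \<forall>j\<ge>1. infdist ((henon a b ^^ j) z) C \<ge> exp (- (alpha K * real j)) / kappa K"
    using wy(3) unfolding wy_good_def wy_critical_set_def Let_def by blast
  moreover have "exp (- (alpha K * real j)) / kappa K > 0" for j using kappa by simp
  ultimately show "z \<in> C \<Longrightarrow> j \<ge> 1 \<Longrightarrow> (henon a b ^^ j) z \<notin> C"
    by (metis infdist_zero not_le)
qed

lemma bij_henon: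
  assumes "b \<noteq> 0"
  shows "bij (henon a b)"
proof (rule bij_betw_byWitness[of _ "\<lambda>(u, v). (v / b, u - 1 + a * (v / b)\<^sup>2)"])
qed (use assms in \<open>auto simp: henon_def\<close>)

lemma inv_mem_unstable_set:
  assumes "q \<in> unstable_set F p"
  shows "inv F q \<in> unstable_set F p"
proof -
  have "(\<lambda>n. (inv F ^^ Suc n) q) \<longlonglongrightarrow> p"
    using assms LIMSEQ_Suc unfolding unstable_set_def by blast
  then show ?thesis unfolding unstable_set_def by (simp add: funpow_swap1)
qed

lemma continuous_strict_antimono:
  fixes h :: "real \<Rightarrow> real"
  assumes "continuous_on UNIV h" "inj h" "x < y" "h y < h x" "u < v"
  shows "h v < h u"
proof -
  \<comment> \<open>All four points lie strictly inside this window, so comparing \<open>h\<close>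
    at its ends decides the direction for both pairs.\<close>
  let ?a = "min x u - 1" and ?b = "max y v + 1"
  have mono: "(h p < h q \<and> h q < h r) \<or> (h r < h q \<and> h q < h p)" if "p < q" "q < r" for p q r
    using continuous_inj_imp_mono[OF that] assms(1,2)
    by (meson continuous_on_subset inj_on_subset subset_UNIV)
  have "h p < h q \<longleftrightarrow> h ?a < h ?b" if "?a < p" "p < q" "q < ?b" for p q
    using mono[of ?a p q] mono[of p q ?b] that by linarith
  from this[of x y] this[of u v] have "\<not> h u < h v" using assms(3-5) by simp
  moreover have "h u \<noteq> h v" using assms(2,5) by (metis injD less_irrefl)
  ultimately show ?thesis by simp
qed

section \<open>Indexing of the basic arcs\<close>

lemma int_isometry_near_eq_id:
  fixes t :: "int \<Rightarrow> int"
  assumes near: "\<And>i j. \<bar>t i - t j\<bar> \<le> 1 \<longleftrightarrow> \<bar>i - j\<bar> \<le> 1" and "t 0 = 0" "0 \<le> t 1"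
  shows "t i = i"
proof -
  \<comment> \<open>Neighbours move by at most 1 and points two apart by more, so the steps are
    nonzero and never turn back.\<close>
  have adj: "\<bar>t i - t (i + 1)\<bar> \<le> 1" "\<bar>t (i + 1) - t (i + 2)\<bar> \<le> 1" "\<not> \<bar>t i - t (i + 2)\<bar> \<le> 1" for i
    using near by auto
  have step: "t (k + 1) = t k + 1" for k
  proof (induction k rule: int_induct[of _ 0])
    case base
    show ?case using adj[of 0] assms(2,3) by simp
  next
    case (step1 i)
    then show ?case using adj[of i] by (simp add: algebra_simps)
  next
    case (step2 i)
    then show ?case using adj[of "i - 1"] by (simp add: algebra_simps)
  qed
  show ?thesis
  proof (induction i rule: int_induct[of _ 0])
    case (step2 i)
    then show ?case using step[of "i - 1"] by simp
  qed (simp_all add: assms(2) step)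
qed

lemma consecutive_nonzero_ints:
  fixes p q :: int
  assumes "p < q" "p \<noteq> 0" "q \<noteq> 0" and gap: "\<And>r. p < r \<Longrightarrow> r < q \<Longrightarrow> r = 0"
  shows "\<exists>i. p = arc_lo i \<and> q = arc_hi i"
proof -
  have "q = p + 1 \<or> p + 1 = 0" using gap[of "p + 1"] assms(1) by linarith
  moreover have "q = p + 1 \<or> q - 1 = 0" using gap[of "q - 1"] assms(1) by linarith
  ultimately consider "p = - 1" "q = 1" | "q = p + 1" by linarith
  then show ?thesis
  proof cases
    case 1
    then show ?thesis by (intro exI[of _ 0]) (simp add: arc_lo_def arc_hi_def)
  next
    case 2
    then show ?thesis using assms(2,3)
      \<comment> \<open>Away from X, an arc has the index of its endpoint nearer to 0.\<close>
      by (intro exI[of _ "if p > 0 then p else q"]) (auto simp: arc_lo_def arc_hi_def)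
  qed
qed

text \<open>The intersections fix the numbering up to translation and reversal; arc 0 excludes the
  former, the side of \<open>I 1\<close> the latter.\<close>

lemma basic_arc_indexing_eq:
  assumes "inj \<phi>" and basic: "\<phi> ` real_of_int ` (UNIV - {0}) = basic_points F X C"
    and ind: "basic_arc_indexing F X C \<phi> I"
  shows "I i = \<phi> ` {real_of_int (arc_lo i)..real_of_int (arc_hi i)}"
proof -
  define A where "A i = {real_of_int (arc_lo i)..real_of_int (arc_hi i)}" for i
  have arcs: "range I = {A. basic_arc F X C \<phi> A}" and I_0: "I 0 = \<phi> ` {- 1..1}"
    and I_1: "I 1 \<subseteq> \<phi> ` {0..}" and meet: "I i \<inter> I j \<noteq> {} \<longleftrightarrow> \<bar>i - j\<bar> \<le> 1" for i j
    using ind by (simp_all add: basic_arc_indexing_def)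
  have basic_iff: "\<phi> t \<in> basic_points F X C \<longleftrightarrow> (\<exists>k. k \<noteq> 0 \<and> t = real_of_int k)" for t
    unfolding basic[symmetric] by (auto simp: image_iff inj_eq[OF assms(1)])
  have "\<exists>i. B = \<phi> ` A i" if B: "basic_arc F X C \<phi> B" for B
  proof -
    obtain s t where st: "s < t" "B = \<phi> ` {s..t}" "\<phi> s \<in> basic_points F X C" "\<phi> t \<in> basic_points F X C"
      and gap: "\<forall>r\<in>{s<..<t}. \<phi> r \<notin> basic_points F X C"
      using B unfolding basic_arc_def by blast
    obtain p q where pq: "p \<noteq> 0" "s = real_of_int p" "q \<noteq> 0" "t = real_of_int q"
      using st(3,4) basic_iff by metis
    have "\<exists>i. p = arc_lo i \<and> q = arc_hi i"
    proof (rule consecutive_nonzero_ints)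
      fix r assume "p < r" "r < q"
      then have "real_of_int r \<in> {s<..<t}" using pq by simp
      with gap have "\<phi> (real_of_int r) \<notin> basic_points F X C" by blast
      then show "r = 0" using basic_iff by blast
    qed (use pq st in auto)
    then show ?thesis using st(2) pq unfolding A_def by blast
  qed
  moreover have "basic_arc F X C \<phi> (I i)" for i
    using arcs rangeI[of I i] by simp
  ultimately have "\<forall>i. \<exists>j. I i = \<phi> ` A j" by simp
  then obtain t where t: "\<And>i. I i = \<phi> ` A (t i)" by metis
  have A_meet: "A i \<inter> A j \<noteq> {} \<longleftrightarrow> \<bar>i - j\<bar> \<le> 1" for i j
  proof -
    have "A i \<inter> A j \<noteq> {} \<longleftrightarrow> arc_lo i \<le> arc_hi j \<and> arc_lo j \<le> arc_hi i"
      by (auto simp: A_def arc_lo_def arc_hi_def)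
    also have "\<dots> \<longleftrightarrow> \<bar>i - j\<bar> \<le> 1"
      by (auto simp: arc_lo_def arc_hi_def split: if_splits)
    finally show ?thesis .
  qed
  have A_inj: "A i = A j \<Longrightarrow> i = j" for i j
    by (auto simp: A_def arc_lo_def arc_hi_def Icc_eq_Icc split: if_splits)
  have "t i = i"
  proof (rule int_isometry_near_eq_id)
    fix i j
    have "I i \<inter> I j \<noteq> {} \<longleftrightarrow> A (t i) \<inter> A (t j) \<noteq> {}"
      unfolding t image_Int[OF assms(1), symmetric] by simp
    then show "\<bar>t i - t j\<bar> \<le> 1 \<longleftrightarrow> \<bar>i - j\<bar> \<le> 1"
      by (simp only: meet A_meet)
  next
    have "I 0 = \<phi> ` A 0" using I_0 by (simp add: A_def arc_lo_def arc_hi_def)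
    then show "t 0 = 0" by (intro A_inj) (simp add: t inj_image_eq_iff[OF assms(1)])
  next
    have "A (t 1) \<subseteq> {0..}" using I_1 by (simp only: t inj_image_subset_iff[OF assms(1)])
    then show "0 \<le> t 1" by (auto simp: A_def arc_lo_def arc_hi_def split: if_splits)
  qed
  then show ?thesis using t A_def by simp
qed

text \<open>Injectivity of \<open>\<phi>\<close> moves everything to the parameter line, where the
  action \<open>h\<close> preserves the integers and restricts to \<open>H\<close>.\<close>

lemma basic_action_of_henon:
  assumes wy: "wy_henon a b X C"
    and fold: "folding_param (henon a b) X C \<phi>"
    and ind: "basic_arc_indexing (henon a b) X C \<phi> I"
  shows "\<exists>H. basic_action H \<and> folding_pattern (henon a b) X C \<phi> = range_pattern H \<and>
             pruned_tree (henon a b) I = arrow H"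
proof -
  let ?F = "henon a b"
  note F_inj = bij_is_inj[OF bij_henon[OF wy_henonD(1)[OF wy]]]
  note F_surj = bij_is_surj[OF bij_henon[OF wy_henonD(1)[OF wy]]]
  from fold have inj: "inj \<phi>" and \<phi>0: "\<phi> 0 = X" and range: "range \<phi> = unstable_set ?F X"
    and basic: "\<phi> ` real_of_int ` (UNIV - {0}) = basic_points ?F X C"
    and crit: "\<phi> (- 1) \<in> basic_critical ?F X C" and \<phi>1: "\<phi> 1 = ?F (\<phi> (- 1))"
    unfolding folding_param_def unstable_param_def by auto
  from fold obtain h where cont: "continuous_on UNIV h" and h: "\<And>t. ?F (\<phi> t) = \<phi> (h t)"
    unfolding folding_param_def unstable_param_def by auto
  have h0: "h 0 = 0" using h[of 0] \<phi>0 wy_henonD(2)[OF wy] injD[OF inj] by metis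
  have hm1: "h (- 1) = 1" using h[of "-1"] \<phi>1 injD[OF inj] by metis
  have h_inj: "inj h" by (metis F_inj h inj inj_def)
  \<comment> \<open>The pair \<open>h (- 1) = 1\<close>, \<open>h 0 = 0\<close> shows the
    direction.\<close>
  have h_anti: "h v < h u" if "u < v" for u v
    using continuous_strict_antimono[OF cont h_inj, of "-1" 0] h0 hm1 that by simp
  have h_surj: "\<exists>s. h s = t" for t
  proof -
    have "inv ?F (\<phi> t) \<in> range \<phi>" using inv_mem_unstable_set range by blast
    then obtain s where "inv ?F (\<phi> t) = \<phi> s" by blast
    then have "\<phi> (h s) = \<phi> t" using h F_surj by (metis surj_f_inv_f)
    then show ?thesis using injD[OF inj] by blast
  qed
  have basic_F: "?F z \<in> basic_points ?F X C" if z: "z \<in> basic_points ?F X C" for z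
  proof -
    obtain n c where "c \<in> basic_critical ?F X C" "z = (?F ^^ n) c"
      using z unfolding basic_points_def by blast
    then have "c \<in> basic_critical ?F X C" "?F z = (?F ^^ Suc n) c" by simp_all
    then show ?thesis unfolding basic_points_def by blast
  qed
  \<comment> \<open>The image of a basic point is an iterate of a critical point with exponent at
    least 1, so non-return applies.\<close>
  have basic_F_not_crit: "?F z \<notin> basic_critical ?F X C" if z: "z \<in> basic_points ?F X C" for z
  proof -
    obtain n c where "c \<in> basic_critical ?F X C" "z = (?F ^^ n) c"
      using z unfolding basic_points_def by blast
    then have "c \<in> C" "?F z = (?F ^^ Suc n) c" by (simp_all add: basic_critical_def)
    then show ?thesis using wy_henonD(3)[OF wy, of c "Suc n"] by (simp add: basic_critical_def)
  qed
  have basic_cases: "z \<in> basic_critical ?F X C \<or> (\<exists>y\<in>basic_points ?F X C. z = ?F y)"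
    if z: "z \<in> basic_points ?F X C" for z
  proof -
    obtain n c where c: "c \<in> basic_critical ?F X C" "z = (?F ^^ n) c"
      using z unfolding basic_points_def by blast
    show ?thesis
    proof (cases n)
      case (Suc m)
      then show ?thesis using c unfolding basic_points_def by auto
    qed (use c in simp)
  qed
  have \<phi>_basic: "\<phi> t \<in> basic_points ?F X C \<longleftrightarrow> (\<exists>k. k \<noteq> 0 \<and> t = real_of_int k)" for t
    unfolding basic[symmetric] by (auto simp: image_iff inj_eq[OF inj])
  have "\<exists>m. h (real_of_int k) = real_of_int m" for k
  proof (cases "k = 0")
    case True
    then show ?thesis using h0 by (intro exI[of _ 0]) simp
  next
    case False
    then show ?thesis using basic_F[of "\<phi> (real_of_int k)"] h \<phi>_basic by metis
  qed
  then obtain H where H: "\<And>k. h (real_of_int k) = real_of_int (H k)" by metis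
  have crit_iff: "\<phi> (real_of_int k) \<in> basic_critical ?F X C \<longleftrightarrow> k \<notin> range H" if "k \<noteq> 0" for k
  proof
    assume crit: "\<phi> (real_of_int k) \<in> basic_critical ?F X C"
    show "k \<notin> range H"
    proof
      assume "k \<in> range H"
      then obtain m where m: "k = H m" by blast
      then have "m \<noteq> 0" using h0 H[of 0] that by auto
      then have "\<phi> (real_of_int m) \<in> basic_points ?F X C" using \<phi>_basic by auto
      from basic_F_not_crit[OF this] show False using crit h H m by simp
    qed
  next
    assume k: "k \<notin> range H"
    have "\<phi> (real_of_int k) \<in> basic_points ?F X C" using \<phi>_basic that by auto
    moreover have False
      if y: "y \<in> basic_points ?F X C" "\<phi> (real_of_int k) = ?F y" for y
    proof -
      obtain m where "y = \<phi> (real_of_int m)" using y(1) basic by blast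
      then have "real_of_int k = real_of_int (H m)" using y(2) h H injD[OF inj] by metis
      then show False using k by simp
    qed
    ultimately show "\<phi> (real_of_int k) \<in> basic_critical ?F X C" using basic_cases by blast
  qed
  have H_anti: "H j < H i" if "i < j" for i j
    using h_anti[of "real_of_int i" "real_of_int j"] that H by simp
  have H0: "H 0 = 0" using h0 H[of 0] by simp
  \<comment> \<open>Index -1 belongs to z_0, which is critical; hence the negative number
    \<open>H 1\<close> is at most -2.\<close>
  have "- 1 \<notin> range H" using crit_iff[of "-1"] crit by simp
  then have "H 1 \<noteq> - 1" by (metis rangeI)
  then have "H 1 < - 1" using H_anti[of 0 1] H0 by simp
  moreover have "H (- 1) = 1" using hm1 H[of "-1"] by simp
  ultimately have action: "basic_action H" using H_anti H0 by unfold_locales auto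
  \<comment> \<open>As \<open>h\<close> is decreasing and onto, it maps an interval onto the full
    interval between the swapped end values.\<close>
  have image: "?F ` I i = \<phi> ` {h (real_of_int (arc_hi i))..h (real_of_int (arc_lo i))}" for i
  proof -
    have "h ` {u..v} = {h v..h u}" for u v
    proof -
      have le: "h x \<le> h y \<longleftrightarrow> y \<le> x" for x y
        using h_anti[of x y] h_anti[of y x] by (cases x y rule: linorder_cases) auto
      show ?thesis
      proof (intro equalityI subsetI)
        fix t assume t: "t \<in> {h v..h u}"
        obtain s where "t = h s" using h_surj by metis
        with t show "t \<in> h ` {u..v}" using le by auto
      qed (auto simp: le)
    qed
    then show ?thesis
      unfolding basic_arc_indexing_eq[OF inj basic ind] image_image h by (metis image_image)
  qed
  have "pruned_tree ?F I i j \<longleftrightarrow> arrow H i j" for i j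
  proof -
    have "pruned_tree ?F I i j \<longleftrightarrow>
        {real_of_int (arc_lo j)..real_of_int (arc_hi j)} \<subseteq>
        {real_of_int (H (arc_hi i))..real_of_int (H (arc_lo i))}"
      unfolding pruned_tree_def image H
      unfolding basic_arc_indexing_eq[OF inj basic ind] inj_image_subset_iff[OF inj] ..
    \<comment> \<open>Nonemptiness reduces the inclusion of intervals to inequalities between
      endpoints.\<close>
    moreover have "arc_lo j \<le> arc_hi j" by (simp add: arc_lo_def arc_hi_def)
    ultimately show ?thesis by (simp add: arrow_def)
  qed
  then have "pruned_tree ?F I = arrow H" by (intro ext) simp
  moreover have "folding_pattern ?F X C \<phi> = range_pattern H"
    unfolding folding_pattern_def range_pattern_def by (rule restrict_ext) (simp add: crit_iff)
  ultimately show ?thesis using action by blast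
qed

theorem theorem6p2:
  fixes a1 b1 a2 b2 :: real and X1 X2 :: plane and C1 C2 :: "plane set"
    and \<phi>1 \<phi>2 :: "real \<Rightarrow> plane" and I1 I2 :: "int \<Rightarrow> plane set"
  assumes "wy_henon a1 b1 X1 C1"
    and "wy_henon a2 b2 X2 C2"
    and "folding_param (henon a1 b1) X1 C1 \<phi>1"
    and "folding_param (henon a2 b2) X2 C2 \<phi>2"
    and "basic_arc_indexing (henon a1 b1) X1 C1 \<phi>1 I1"
    and "basic_arc_indexing (henon a2 b2) X2 C2 \<phi>2 I2"
  shows "folding_pattern (henon a1 b1) X1 C1 \<phi>1 = folding_pattern (henon a2 b2) X2 C2 \<phi>2 \<longleftrightarrow>
         same_pruned_tree (pruned_tree (henon a1 b1) I1) (pruned_tree (henon a2 b2) I2)"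
proof -
  obtain H1 where 1: "basic_action H1"
    "folding_pattern (henon a1 b1) X1 C1 \<phi>1 = range_pattern H1"
    "pruned_tree (henon a1 b1) I1 = arrow H1"
    using basic_action_of_henon[OF assms(1,3,5)] by blast
  obtain H2 where 2: "basic_action H2"
    "folding_pattern (henon a2 b2) X2 C2 \<phi>2 = range_pattern H2"
    "pruned_tree (henon a2 b2) I2 = arrow H2"
    using basic_action_of_henon[OF assms(2,4,6)] by blast
  show ?thesis unfolding 1 2 by (rule pattern_eq_iff_same_pruned_tree[OF 1(1) 2(1)])
qed

end
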